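(* Let $p,q$ be complex numbers. The generating function of the products $j_{p,q,n}j_{p,q,2n+1}$ of $(p,q)$-Jacobsthal Lucas numbers is, as a formal power series in $z$, $$\sum_{n=0}^{\infty}j_{p,q,n}j_{p,q,2n+1}z^n=\frac{2p-p^2(p^2+2q)z+12pq^2(p^2+4q)z^2-16p^2q^4z^3}{1-p(p^2+4q)z-2q(p^4+6p^2q+8q^2)z^2+8pq^3(p^2+4q)z^3+64q^6z^4}.$$
   Context: The $(p,q)$-Jacobsthal Lucas numbers are defined by $j_{p,q,0}=2$, $j_{p,q,1}=p$, and $j_{p,q,n}=pj_{p,q,n-1}+2qj_{p,q,n-2}$ for $n\ge 2$. *)

theory Defs
  imports "HOL-Computational_Algebra.Formal_Power_Series" "HOL.Complex"
begin

fun jacobsthal_lucas :: "complex \<Rightarrow> complex \<Rightarrow> nat \<Rightarrow> complex" where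
  "jacobsthal_lucas p q 0 = 2"
| "jacobsthal_lucas p q (Suc 0) = p"
| "jacobsthal_lucas p q (Suc (Suc n)) =
     p * jacobsthal_lucas p q (Suc n) + 2 * q * jacobsthal_lucas p q n"

end

theory Submission imports Defs begin

text \<open>By Binet's formula the sequence is \<open>a ^ n + b ^ n\<close> with \<open>a + b = p\<close> and \<open>a * b = - 2 * q\<close>, so
the products satisfy the linear recurrence whose characteristic roots are \<open>a ^ 3\<close>, \<open>a ^ 2 * b\<close>,
\<open>a * b ^ 2\<close> and \<open>b ^ 3\<close>. The denominator is the reciprocal polynomial of this recurrence, and the
numerator records the first four values.\<close>

text \<open>Unfolding the recursion makes both sides bilinear in the values at \<open>n\<close>,
  \<open>n + 1\<close> and those at \<open>2 * n\<close>, \<open>2 * n + 1\<close>. What remains is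
  a polynomial identity in these values, \<open>p\<close> and \<open>q\<close>, valid for any
  initial values.\<close>

lemma jacobsthal_lucas_product_recurrence:
  fixes p q :: complex
  defines "f \<equiv> \<lambda>n. jacobsthal_lucas p q n * jacobsthal_lucas p q (2 * n + 1)"
  shows "f (n + 4) = p * (p^2 + 4 * q) * f (n + 3)
    + 2 * q * (p^4 + 6 * p^2 * q + 8 * q^2) * f (n + 2)
    - 8 * p * q^3 * (p^2 + 4 * q) * f (n + 1) - 64 * q^6 * f n"
  by (simp add: f_def numeral_eq_Suc) algebra


theorem theorem17:
  fixes p q :: complex
  shows "Abs_fps (\<lambda>n. jacobsthal_lucas p q n * jacobsthal_lucas p q (2 * n + 1)) =
    (fps_const (2 * p)
      - fps_const (p^2 * (p^2 + 2 * q)) * fps_X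
      + fps_const (12 * p * q^2 * (p^2 + 4 * q)) * fps_X^2
      - fps_const (16 * p^2 * q^4) * fps_X^3) /
    (1 - fps_const (p * (p^2 + 4 * q)) * fps_X
      - fps_const (2 * q * (p^4 + 6 * p^2 * q + 8 * q^2)) * fps_X^2
      + fps_const (8 * p * q^3 * (p^2 + 4 * q)) * fps_X^3
      + fps_const (64 * q^6) * fps_X^4)"
    (is "?F = ?N / ?D")
proof -
  define f where "f = (\<lambda>n. jacobsthal_lucas p q n * jacobsthal_lucas p q (2 * n + 1))"
  have rec: "f (m + 4) = p * (p^2 + 4 * q) * f (m + 3)
    + 2 * q * (p^4 + 6 * p^2 * q + 8 * q^2) * f (m + 2)
    - 8 * p * q^3 * (p^2 + 4 * q) * f (m + 1) - 64 * q^6 * f m" for m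
    unfolding f_def by (rule jacobsthal_lucas_product_recurrence)
  \<comment> \<open>The two factors are the sequence at \<open>n\<close> and at
    \<open>2 * n + 1\<close>.\<close>
  have init: "f 0 = 2 * p" "f 1 = p * (p^3 + 6 * p * q)"
    "f 2 = (p^2 + 4 * q) * (p^5 + 10 * p^3 * q + 20 * p * q^2)"
    "f 3 = (p^3 + 6 * p * q) * (p^7 + 14 * p^5 * q + 56 * p^3 * q^2 + 56 * p * q^3)"
    by (simp_all add: f_def numeral_eq_Suc) algebra+
  have "Abs_fps f * ?D = ?N"
  proof (rule fps_ext)
    fix n :: nat
    \<comment> \<open>Multiplication by \<open>fps_X ^ k\<close> shifts the coefficients by
      \<open>k\<close>; the guards give 0 where \<open>n - k\<close> would be truncated.\<close>
    have expand: "fps_nth (Abs_fps f * ?D) n = f n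
        - (if n < 1 then 0 else f (n - 1)) * (p * (p^2 + 4 * q))
        - (if n < 2 then 0 else f (n - 2)) * (2 * q * (p^4 + 6 * p^2 * q + 8 * q^2))
        + (if n < 3 then 0 else f (n - 3)) * (8 * p * q^3 * (p^2 + 4 * q))
        + (if n < 4 then 0 else f (n - 4)) * (64 * q^6)"
      by (simp add: distrib_left right_diff_distrib mult.assoc [symmetric]
          fps_X_power_mult_right_nth del: fps_const_mult fps_const_add fps_const_power)
    consider "n = 0" | "n = 1" | "n = 2" | "n = 3" | m where "n = m + 4"
    proof (cases "n < 4")
      case True
      then show ?thesis using that by linarith
    next
      case False
      then show ?thesis using that(5) [of "n - 4"] by simp
    qed
    then show "fps_nth (Abs_fps f * ?D) n = fps_nth ?N n"
    proof cases
      case 1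
      show ?thesis unfolding expand by (simp add: 1 init)
    next
      case 2
      show ?thesis unfolding expand
        by (simp add: 2 init [simplified])
          (simp add: algebra_simps power2_eq_square power3_eq_cube)
    next
      case 3
      show ?thesis unfolding expand
        by (simp add: 3 init [simplified] fps_X_power_nth)
          (simp add: algebra_simps numeral_eq_Suc)
    next
      case 4
      show ?thesis unfolding expand
        by (simp add: 4 init [simplified] fps_X_power_nth)
          (simp add: algebra_simps numeral_eq_Suc)
    next
      case 5
      \<comment> \<open>The numerator has no terms beyond degree 3, so from here on the coefficient
        must vanish, which is \<open>rec\<close>.\<close>
      have "n - 1 = m + 3" "n - 2 = m + 2" "n - 3 = m + 1" "n - 4 = m" using 5 by auto
      then show ?thesis unfolding expand using 5 rec [of m]
        by (simp add: fps_X_power_nth add.commute [of 3])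
    qed
  qed
  \<comment> \<open>The constant term of the denominator is 1.\<close>
  moreover have "?D \<noteq> 0"
  proof
    assume "?D = 0"
    then have "fps_nth ?D 0 = fps_nth 0 0" by (rule arg_cong)
    then show False by simp
  qed
  ultimately have "Abs_fps f = ?N / ?D"
    using nonzero_mult_div_cancel_right [of ?D "Abs_fps f"] by (simp only: not_False_eq_True)
  then show ?thesis unfolding f_def .
qed

end
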